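(* Let $n\ge 1$ be an integer, let $S^n\subset\mathbb{R}^{n+1}$ be the unit sphere with the Euclidean metric, and let $\{\omega_N\}_{N\ge 2}$ be a sequence in which each $\omega_N$ is an $N$-point best-packing configuration on $S^n$. Then $$\gamma(\omega_N,S^n)\ge\frac12\left(\frac{\Theta_n}{\Delta_n}\right)^{1/n}+o(1),\qquad N\to\infty,$$ where $\Delta_n$ and $\Theta_n$ are the sphere packing and covering constants in $\mathbb{R}^n$.
   Context: For a compact infinite metric space $(A,\rho)$ and a configuration $\omega_N=\{x_i\}_{i=1}^N\subset A$ of $N\ge2$ distinct points: the separation distance is $\delta(\omega_N):=\min_{i\ne j}\rho(x_i,x_j)$; the mesh norm (covering radius) relative to $A$ is $\eta(\omega_N,A):=\max_{y\in A}\min_{1\le i\le N}\rho(y,x_i)$; the mesh-separation ratio is $\gamma(\omega_N,A):=\eta(\omega_N,A)/\delta(\omega_N)$. Set $\delta_N(A):=\max\{\delta(\omega_N):\omega_N\subset A,\ \#\omega_N=N\}$ and $\eta_N(A):=\min\{\eta(\omega_N,A):\omega_N\subset A,\ \#\omega_N=N\}$; $\omega_N$ is a best-packing configuration on $A$ if $\delta(\omega_N)=\delta_N(A)$. With $U_n:=[0,1]^n$ the unit cube in $\mathbb{R}^n$ (Euclidean metric) and $\beta_n$ the volume of the unit ball in $\mathbb{R}^n$, the sphere packing and covering constants are $$\Delta_n:=\lim_{N\to\infty}N\left(\frac{\delta_N(U_n)}{2}\right)^n\beta_n,\qquad \Theta_n:=\lim_{N\to\infty}N\,\eta_N(U_n)^n\beta_n,$$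 where the existence (as positive finite numbers) of these limits is well known. *)

theory Defs
  imports "HOL-Analysis.Analysis" "HOL-Library.Landau_Symbols"
begin

text \<open>A configuration of \<open>N\<close> distinct points of \<open>A\<close> is a finite subset of \<open>A\<close> with \<open>N\<close> elements;
  the metric on \<open>A\<close> is the restriction of that of the ambient space.\<close>

definition configs :: "nat \<Rightarrow> 'a set \<Rightarrow> 'a set set" where
  "configs N A = {\<omega>. \<omega> \<subseteq> A \<and> finite \<omega> \<and> card \<omega> = N}"

text \<open>Meaningful for finite \<open>\<omega>\<close> with at least two points.\<close>

definition separation :: "'a::metric_space set \<Rightarrow> real" where
  "separation \<omega> = Min {dist x y | x y. x \<in> \<omega> \<and> y \<in> \<omega> \<and> x \<noteq> y}"

text \<open>For compact infinite \<open>A\<close> and \<open>N \<ge> 2\<close>, the suprema and the infimum below are attained, so they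
  are the maxima and the minimum of the usual definitions.\<close>

definition mesh_norm :: "'a::metric_space set \<Rightarrow> 'a set \<Rightarrow> real" where
  "mesh_norm \<omega> A = (SUP y\<in>A. Min ((\<lambda>x. dist y x) ` \<omega>))"

definition mesh_ratio :: "'a::metric_space set \<Rightarrow> 'a set \<Rightarrow> real" where
  "mesh_ratio \<omega> A = mesh_norm \<omega> A / separation \<omega>"

definition max_separation :: "nat \<Rightarrow> 'a::metric_space set \<Rightarrow> real" where
  "max_separation N A = (SUP \<omega>\<in>configs N A. separation \<omega>)"

definition min_mesh_norm :: "nat \<Rightarrow> 'a::metric_space set \<Rightarrow> real" where
  "min_mesh_norm N A = (INF \<omega>\<in>configs N A. mesh_norm \<omega> A)"

definition best_packing :: "nat \<Rightarrow> 'a::metric_space set \<Rightarrow> 'a set \<Rightarrow> bool" where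
  "best_packing N A \<omega> \<longleftrightarrow> \<omega> \<in> configs N A \<and> separation \<omega> = max_separation N A"

text \<open>The constants of \<open>\<real>\<^sup>n\<close> with \<open>n = CARD('n)\<close>; \<open>cbox 0 1\<close> is the cube \<open>[0,1]\<^sup>n\<close>.\<close>

definition packing_const :: "'n::finite itself \<Rightarrow> real" where
  "packing_const _ = lim (\<lambda>N. real N * (max_separation N (cbox 0 1 :: (real ^ 'n) set) / 2) ^ CARD('n)
     * measure lborel (cball (0 :: real ^ 'n) 1))"

definition covering_const :: "'n::finite itself \<Rightarrow> real" where
  "covering_const _ = lim (\<lambda>N. real N * min_mesh_norm N (cbox 0 1 :: (real ^ 'n) set) ^ CARD('n)
     * measure lborel (cball (0 :: real ^ 'n) 1))"

end

theory Submission
  imports Defs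
begin

text \<open>The argument is local: it compares packing and covering near a single point of the sphere.
  Subdividing the cube into \<open>k\<^sup>n\<close> subcubes gives \<open>\<delta>\<^sub>K \<le> \<delta>\<^sub>N / k\<close> and \<open>\<eta>\<^sub>K \<le> \<eta>\<^sub>N / k\<close> for \<open>K \<ge> k\<^sup>n N\<close>; hence
  \<open>N \<delta>\<^sub>N\<^sup>n\<close> and \<open>N \<eta>\<^sub>N\<^sup>n\<close> converge to their infima \<open>p\<close> and \<open>c\<close>. Near a pole, the orthogonal projection
  of the sphere to the equatorial hyperplane is \<open>(1 + e)\<close>-bi-Lipschitz. The \<open>m\<close> points of \<open>\<omega>\<^sub>N\<close> over the
  \<open>\<eta>\<close>-neighbourhood of a fixed small cube of side \<open>s\<close> cover this cube with radius \<open>\<eta>\<close>, so that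
  \<open>c (s / \<eta>)\<^sup>n \<le> m\<close>, and their projections have separation at least \<open>\<delta> / (1 + e)\<close>, so that
  \<open>m \<le> (p + e) ((1 + e) (s + 2 \<eta>) / \<delta>)\<^sup>n\<close>. Comparing the two bounds on \<open>m\<close> for the same configuration
  gives \<open>\<eta> / \<delta> \<ge> (c / p)\<^sup>1\<^sup>/\<^sup>n - o(1)\<close>.\<close>

section \<open>Separation and mesh norm of finite configurations\<close>

lemma separation_attained:
  fixes \<omega> :: "'a::metric_space set"
  assumes "finite \<omega>" "card \<omega> \<ge> 2"
  obtains x y where "x \<in> \<omega>" "y \<in> \<omega>" "x \<noteq> y" "separation \<omega> = dist x y"
    "\<And>u v. u \<in> \<omega> \<Longrightarrow> v \<in> \<omega> \<Longrightarrow> u \<noteq> v \<Longrightarrow> separation \<omega> \<le> dist u v"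
proof -
  let ?D = "{dist x y | x y. x \<in> \<omega> \<and> y \<in> \<omega> \<and> x \<noteq> y}"
  have "?D \<subseteq> (\<lambda>(x, y). dist x y) ` (\<omega> \<times> \<omega>)" by auto
  then have fin: "finite ?D" using assms(1) by (meson finite_SigmaI finite_imageI finite_subset)
  have "\<exists>x y. x \<in> \<omega> \<and> y \<in> \<omega> \<and> x \<noteq> y"
    using assms card_le_Suc0_iff_eq[OF assms(1)] by force
  then have "?D \<noteq> {}" by blast
  with fin have "separation \<omega> \<in> ?D" unfolding separation_def by (rule Min_in)
  then obtain x y where "x \<in> \<omega>" "y \<in> \<omega>" "x \<noteq> y" "separation \<omega> = dist x y" by blast
  moreover have "separation \<omega> \<le> dist u v" if "u \<in> \<omega>" "v \<in> \<omega>" "u \<noteq> v" for u v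
    unfolding separation_def using that by (intro Min_le[OF fin]) blast
  ultimately show thesis using that by blast
qed

lemma separation_le_dist:
  fixes \<omega> :: "'a::metric_space set"
  assumes "finite \<omega>" "card \<omega> \<ge> 2" "x \<in> \<omega>" "y \<in> \<omega>" "x \<noteq> y"
  shows "separation \<omega> \<le> dist x y"
  using separation_attained[OF assms(1,2)] assms(3-5) by metis

lemma separation_pos:
  fixes \<omega> :: "'a::metric_space set"
  assumes "finite \<omega>" "card \<omega> \<ge> 2"
  shows "separation \<omega> > 0"
  using separation_attained[OF assms] by (metis zero_less_dist_iff)

lemma configs_nonempty: "infinite A \<Longrightarrow> configs N A \<noteq> {}"
  using infinite_arbitrarily_large[of A N] by (auto simp: configs_def)

text \<open>Thinning \<open>\<omega>\<close> to exactly \<open>N\<close> points keeps every pairwise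
  distance at least \<open>t\<close>. Boundedness of \<open>A\<close> bounds all separations, so the
  supremum is a true upper bound.\<close>

lemma max_separation_ge:
  fixes A :: "'a::metric_space set"
  assumes "bounded A" "finite \<omega>" "\<omega> \<subseteq> A" "N \<ge> 2" "N \<le> card \<omega>"
    and sep: "\<And>x y. x \<in> \<omega> \<Longrightarrow> y \<in> \<omega> \<Longrightarrow> x \<noteq> y \<Longrightarrow> t \<le> dist x y"
  shows "t \<le> max_separation N A"
proof -
  obtain X where X: "X \<subseteq> \<omega>" "card X = N" "finite X"
    using obtain_subset_with_card_n[OF assms(5)] by metis
  obtain e where e: "\<And>x y. x \<in> A \<Longrightarrow> y \<in> A \<Longrightarrow> dist x y \<le> e"
    using assms(1) by (auto simp: bounded_two_points)
  have "separation \<psi> \<le> e" if "\<psi> \<in> configs N A" for \<psi>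
  proof -
    have \<psi>: "finite \<psi>" "card \<psi> \<ge> 2" "\<psi> \<subseteq> A" using that assms(4) by (auto simp: configs_def)
    then show ?thesis using separation_attained[OF \<psi>(1,2)] e by (metis subsetD)
  qed
  then have "bdd_above (separation ` configs N A)" by (auto simp: bdd_above_def)
  moreover have "X \<in> configs N A" using X assms(3) by (auto simp: configs_def)
  ultimately have "separation X \<le> max_separation N A"
    unfolding max_separation_def by (rule cSUP_upper[rotated])
  moreover have "t \<le> separation X"
    using separation_attained[of X] X sep assms(4) by (metis subsetD)
  ultimately show ?thesis by simp
qed

lemma mesh_norm_le:
  fixes A :: "'a::metric_space set"
  assumes "A \<noteq> {}" "finite \<omega>" "\<And>y. y \<in> A \<Longrightarrow> \<exists>x\<in>\<omega>. dist y x \<le> r"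
  shows "mesh_norm \<omega> A \<le> r"
  unfolding mesh_norm_def
proof (rule cSUP_least[OF assms(1)])
  fix y assume "y \<in> A"
  with assms(3) obtain x where "x \<in> \<omega>" "dist y x \<le> r" by blast
  then show "Min ((\<lambda>x. dist y x) ` \<omega>) \<le> r"
    using assms(2) by (meson Min_le finite_imageI imageI order_trans)
qed

lemma dist_le_mesh_norm:
  fixes A :: "'a::metric_space set"
  assumes "bounded A" "finite \<omega>" "\<omega> \<noteq> {}" "y \<in> A"
  obtains x where "x \<in> \<omega>" "dist y x \<le> mesh_norm \<omega> A"
proof -
  obtain z where z: "z \<in> \<omega>" using assms(3) by blast
  obtain e where e: "\<And>y. y \<in> A \<Longrightarrow> dist z y \<le> e"
    using assms(1) bounded_any_center[of A z] by auto
  have "Min ((\<lambda>x. dist y x) ` \<omega>) \<le> e" if "y \<in> A" for y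
    using e[OF that] z assms(2) by (metis Min_le dist_commute finite_imageI imageI order_trans)
  then have "bdd_above ((\<lambda>y. Min ((\<lambda>x. dist y x) ` \<omega>)) ` A)" by (auto simp: bdd_above_def)
  then have le: "Min ((\<lambda>x. dist y x) ` \<omega>) \<le> mesh_norm \<omega> A"
    unfolding mesh_norm_def by (rule cSUP_upper[OF assms(4)])
  have "Min ((\<lambda>x. dist y x) ` \<omega>) \<in> (\<lambda>x. dist y x) ` \<omega>"
    using assms(2,3) by (intro Min_in) auto
  then show thesis using le that by auto
qed

lemma mesh_norm_nonneg:
  fixes A :: "'a::metric_space set"
  assumes "bounded A" "A \<noteq> {}" "finite \<omega>" "\<omega> \<noteq> {}"
  shows "mesh_norm \<omega> A \<ge> 0"
  using assms dist_le_mesh_norm[of A \<omega>] by (metis all_not_in_conv dual_order.trans zero_le_dist)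

lemma min_mesh_norm_nonneg:
  fixes A :: "'a::metric_space set"
  assumes "bounded A" "infinite A" "N \<ge> 1"
  shows "min_mesh_norm N A \<ge> 0"
  unfolding min_mesh_norm_def
proof (rule cINF_greatest[OF configs_nonempty[OF assms(2)]])
  fix \<omega> assume "\<omega> \<in> configs N A"
  then have "finite \<omega>" "\<omega> \<noteq> {}" using assms(3) by (auto simp: configs_def)
  then show "mesh_norm \<omega> A \<ge> 0" using mesh_norm_nonneg assms by (metis finite.emptyI)
qed

text \<open>Points of the infinite set \<open>A\<close> pad \<open>X\<close> to exactly
  \<open>N\<close> points, and extra centres cannot spoil a covering. Nonnegativity of mesh norms
  keeps the infimum bounded below.\<close>

lemma min_mesh_norm_le:
  fixes A :: "'a::metric_space set"
  assumes "bounded A" "infinite A" "X \<subseteq> A" "finite X" "card X \<le> N" "N \<ge> 1"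
    and cov: "\<And>y. y \<in> A \<Longrightarrow> \<exists>x\<in>X. dist y x \<le> r"
  shows "min_mesh_norm N A \<le> r"
proof -
  have "infinite (A - X)" using assms by simp
  then obtain Y where Y: "finite Y" "card Y = N - card X" "Y \<subseteq> A - X"
    using infinite_arbitrarily_large by blast
  then have "card (X \<union> Y) = N"
    using assms by (subst card_Un_disjoint) auto
  then have XY: "X \<union> Y \<in> configs N A" using Y assms by (auto simp: configs_def)
  have "mesh_norm \<omega> A \<ge> 0" if "\<omega> \<in> configs N A" for \<omega>
    using that assms(1,2,6) by (intro mesh_norm_nonneg) (auto simp: configs_def)
  then have "bdd_below ((\<lambda>\<omega>. mesh_norm \<omega> A) ` configs N A)" by (auto simp: bdd_below_def)
  then have "min_mesh_norm N A \<le> mesh_norm (X \<union> Y) A"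
    unfolding min_mesh_norm_def by (rule cINF_lower[OF _ XY])
  also have "\<dots> \<le> r"
  proof (rule mesh_norm_le)
    show "A \<noteq> {}" using assms(2) by auto
    show "finite (X \<union> Y)" using Y assms by simp
    show "\<exists>x\<in>X \<union> Y. dist y x \<le> r" if "y \<in> A" for y using cov[OF that] by blast
  qed
  finally show ?thesis .
qed

section \<open>Rescaling cubes to the unit cube\<close>

lemma infinite_unit_cube: "infinite (cbox 0 1 :: (real ^ 'n::finite) set)"
proof -
  have "inj_on (\<lambda>t. t *\<^sub>R (1 :: real ^ 'n)) {0..1}"
    by (auto simp: inj_on_def vec_eq_iff)
  moreover have "(\<lambda>t. t *\<^sub>R (1 :: real ^ 'n)) ` {0..1} \<subseteq> cbox 0 1"
    by (auto simp: mem_box_cart)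
  moreover have "infinite {0..1::real}" by simp
  ultimately show ?thesis by (meson finite_imageD finite_subset)
qed

text \<open>The similarity taking the cube with corner \<open>a\<close> and side \<open>t\<close> to
  the unit cube divides all distances by \<open>t\<close>.\<close>

lemma max_separation_unit_cube_ge:
  fixes X :: "(real ^ 'n::finite) set"
  assumes "finite X" "N \<ge> 2" "N \<le> card X" "t > 0"
    and sep: "\<And>x y. x \<in> X \<Longrightarrow> y \<in> X \<Longrightarrow> x \<noteq> y \<Longrightarrow> d \<le> dist x y"
    and box: "\<And>x i. x \<in> X \<Longrightarrow> a $ i \<le> x $ i \<and> x $ i \<le> a $ i + t"
  shows "d / t \<le> max_separation N (cbox 0 1 :: (real ^ 'n) set)"
proof -
  define f where "f x = (1 / t) *\<^sub>R (x - a)" for x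
  have d: "dist (f x) (f y) = dist x y / t" for x y
    using assms(4) unfolding f_def dist_norm by (simp flip: scaleR_diff_right)
  have inj: "inj_on f X"
    by (rule inj_onI) (use d assms(4) in \<open>metis dist_eq_0_iff divide_eq_0_iff less_irrefl\<close>)
  show ?thesis
  proof (rule max_separation_ge)
    show "f ` X \<subseteq> cbox 0 1"
      using box assms(4) by (auto simp: mem_box_cart f_def field_simps)
    show "N \<le> card (f ` X)" using assms(3) inj by (simp add: card_image)
    show "d / t \<le> dist x y" if "x \<in> f ` X" "y \<in> f ` X" "x \<noteq> y" for x y
    proof -
      from that obtain u v where "u \<in> X" "v \<in> X" "x = f u" "y = f v" "u \<noteq> v" by blast
      then show ?thesis using sep[of u v] assms(4) by (simp add: d divide_right_mono)
    qed
  qed (use assms in auto)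
qed

text \<open>The points of \<open>X\<close> need not lie in the cube: clamping them to it does not increase distances
  to points of the cube.\<close>

lemma min_mesh_norm_unit_cube_le:
  fixes X :: "(real ^ 'n::finite) set"
  assumes "finite X" "card X \<le> N" "N \<ge> 1" "t > 0"
    and cov: "\<And>y. \<forall>i. a $ i \<le> y $ i \<and> y $ i \<le> a $ i + t \<Longrightarrow> \<exists>x\<in>X. dist y x \<le> r"
  shows "min_mesh_norm N (cbox 0 1 :: (real ^ 'n) set) \<le> r / t"
proof -
  define f where "f x = clamp 0 1 ((1 / t) *\<^sub>R (x - a))" for x :: "real ^ 'n"
  have le: "\<forall>i\<in>Basis. (0 :: real ^ 'n) \<bullet> i \<le> 1 \<bullet> i"
    by (auto simp: Basis_vec_def inner_axis)
  show ?thesis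
  proof (rule min_mesh_norm_le)
    show "f ` X \<subseteq> cbox 0 1" using le by (auto simp: f_def)
    show "card (f ` X) \<le> N" using assms(1,2) card_image_le order_trans by blast
    fix y :: "real ^ 'n" assume y: "y \<in> cbox 0 1"
    define z where "z = a + t *\<^sub>R y"
    have "\<forall>i. a $ i \<le> z $ i \<and> z $ i \<le> a $ i + t"
      using y assms(4) by (auto simp: mem_box_cart z_def mult_left_le)
    then obtain x where x: "x \<in> X" "dist z x \<le> r" using cov by blast
    \<comment> \<open>Since \<open>y\<close> lies in the cube, \<open>clamp\<close> fixes it; as
      \<open>clamp\<close> is 1-Lipschitz, \<open>y\<close> can be compared with
      \<open>f x\<close>.\<close>
    have "y = clamp 0 1 ((1 / t) *\<^sub>R (z - a))" using y assms(4) by (simp add: z_def)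
    then have "dist y (f x) \<le> dist ((1 / t) *\<^sub>R (z - a)) ((1 / t) *\<^sub>R (x - a))"
      unfolding f_def by (metis dist_clamps_le_dist_args)
    also have "\<dots> = dist z x / t"
      using assms(4) unfolding dist_norm by (simp flip: scaleR_diff_right)
    also have "\<dots> \<le> r / t" using x assms(4) by (simp add: divide_right_mono)
    finally show "\<exists>x\<in>f ` X. dist y x \<le> r / t" using x by blast
  qed (use assms infinite_unit_cube in auto)
qed

section \<open>Subdivision of the cube and convergence to the infimum\<close>

lemma subcube_index:
  assumes "(k::nat) \<ge> 1" "0 \<le> (x::real)" "x \<le> 1"
  obtains j where "j < k" "real j / k \<le> x" "x \<le> real j / k + 1 / k"
proof (cases "x = 1")
  case True
  \<comment> \<open>At the right end point the floor of \<open>k * x\<close> would be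
    \<open>k\<close>, so the last interval is taken instead.\<close>
  then show ?thesis using assms by (intro that[of "k - 1"]) (auto simp: field_simps)
next
  case False
  define j where "j = nat \<lfloor>k * x\<rfloor>"
  have j: "real j \<le> k * x" "k * x \<le> real j + 1"
    unfolding j_def using assms by (auto simp: le_floor_iff) linarith?
  moreover have "k * x < k" using False assms by (simp add: mult_less_cancel_left2)
  ultimately have "j < k" by linarith
  with j show ?thesis using assms by (intro that[of j]) (auto simp: field_simps)
qed

text \<open>By pigeonhole one of the \<open>k^n\<close> subcubes of side \<open>1 / k\<close>
  contains at least \<open>N\<close> of the \<open>K\<close> points. Enlarging it by the factor
  \<open>k\<close> gives \<open>N\<close> points in the unit cube.\<close>

lemma max_separation_subdivide:
  fixes N k K :: nat
  defines "\<delta> \<equiv> \<lambda>N. max_separation N (cbox 0 1 :: (real ^ 'n::finite) set)"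
  assumes "N \<ge> 2" "k \<ge> 1" "K \<ge> k ^ CARD('n) * N"
  shows "\<delta> K \<le> \<delta> N / k"
  unfolding \<delta>_def max_separation_def[of K]
proof (rule cSUP_least[OF configs_nonempty[OF infinite_unit_cube]])
  fix \<omega> :: "(real ^ 'n) set" assume "\<omega> \<in> configs K (cbox 0 1)"
  then have \<omega>: "\<omega> \<subseteq> cbox 0 1" "finite \<omega>" "card \<omega> = K" by (auto simp: configs_def)
  have "1 * 2 \<le> k ^ CARD('n) * N" using assms by (intro mult_mono) auto
  with \<omega> assms have "card \<omega> \<ge> 2" by linarith
  note sep = separation_le_dist[OF \<omega>(2) this]
  define J where "J = (UNIV :: 'n set) \<rightarrow>\<^sub>E {..<k}"
  have J: "finite J" "card J = k ^ CARD('n)" by (auto simp: J_def card_funcsetE finite_PiE)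
  have "\<exists>j\<in>J. \<forall>i. real (j i) / k \<le> x $ i \<and> x $ i \<le> real (j i) / k + 1 / k" if "x \<in> \<omega>" for x
  proof -
    have "\<forall>i. \<exists>j. j < k \<and> real j / k \<le> x $ i \<and> x $ i \<le> real j / k + 1 / k"
      using that \<omega>(1) subcube_index[OF assms(3)] by (metis mem_box_cart(2) one_index subsetD zero_index)
    then obtain j where "\<forall>i. j i < k \<and> real (j i) / k \<le> x $ i \<and> x $ i \<le> real (j i) / k + 1 / k"
      by metis
    then show ?thesis by (intro bexI[of _ j]) (auto simp: J_def)
  qed
  then obtain f where f: "\<And>x. x \<in> \<omega> \<Longrightarrow> f x \<in> J"
    "\<And>x i. x \<in> \<omega> \<Longrightarrow> real (f x i) / k \<le> x $ i \<and> x $ i \<le> real (f x i) / k + 1 / k"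
    by metis
  have "J \<noteq> {}" using J(2) assms(3) by auto
  then obtain j where j: "j \<in> J" "card (f -` {j} \<inter> \<omega>) * card J \<ge> card \<omega>"
    using pigeonhole_card[of f \<omega> J] f(1) \<omega>(2) J(1) by auto
  then have "k ^ CARD('n) * N \<le> k ^ CARD('n) * card (f -` {j} \<inter> \<omega>)"
    using J(2) \<omega>(3) assms(4) by (metis mult.commute order_trans)
  then have "N \<le> card (f -` {j} \<inter> \<omega>)" using assms(3) by simp
  then have "separation \<omega> / (1 / k) \<le> max_separation N (cbox 0 1 :: (real ^ 'n) set)"
    using assms \<omega>(2) sep f(2)
    by (intro max_separation_unit_cube_ge[where X = "f -` {j} \<inter> \<omega>" and a = "\<chi> i. real (j i) / k"]) auto
  then show "separation \<omega> \<le> max_separation N (cbox 0 1 :: (real ^ 'n) set) / k"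
    using assms(3) by (simp add: field_simps)
qed

text \<open>Copies of a configuration shrunk by the factor \<open>k\<close>, one in each of the
  \<open>k^n\<close> subcubes, cover the cube with the radius divided by \<open>k\<close>. Copies
  may share points on common faces, so only an upper bound on their number is claimed.\<close>

lemma min_mesh_norm_subdivide:
  fixes N k K :: nat
  defines "\<eta> \<equiv> \<lambda>N. min_mesh_norm N (cbox 0 1 :: (real ^ 'n::finite) set)"
  assumes "N \<ge> 2" "k \<ge> 1" "K \<ge> k ^ CARD('n) * N"
  shows "\<eta> K \<le> \<eta> N / k"
proof -
  \<comment> \<open>The factor \<open>k\<close> stands on the left so that the right side is a term
    of the infimum defining \<open>\<eta> N\<close>.\<close>
  have "k * \<eta> K \<le> mesh_norm \<omega> (cbox 0 1)"
    if "\<omega> \<in> configs N (cbox 0 1)" for \<omega> :: "(real ^ 'n) set"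
  proof -
    have \<omega>: "\<omega> \<subseteq> cbox 0 1" "finite \<omega>" "card \<omega> = N" "\<omega> \<noteq> {}"
      using that assms by (auto simp: configs_def)
    define J where "J = (UNIV :: 'n set) \<rightarrow>\<^sub>E {..<k}"
    have J: "finite J" "card J = k ^ CARD('n)" by (auto simp: J_def card_funcsetE finite_PiE)
    define g :: "('n \<Rightarrow> nat) \<times> (real ^ 'n) \<Rightarrow> real ^ 'n"
      where "g = (\<lambda>(j, x). (1 / real k) *\<^sub>R ((\<chi> i. real (j i)) + x))"
    \<comment> \<open>The division by 1 matches the scaling lemma for a cube of side
      \<open>t = 1\<close>.\<close>
    have "\<eta> K \<le> (mesh_norm \<omega> (cbox 0 1) / k) / 1"
      unfolding \<eta>_def
    proof (rule min_mesh_norm_unit_cube_le[where X = "g ` (J \<times> \<omega>)" and a = 0])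
      have "card (g ` (J \<times> \<omega>)) \<le> card (J \<times> \<omega>)" using J \<omega> by (intro card_image_le) auto
      also have "\<dots> \<le> K" using J \<omega> assms by (simp add: card_cartesian_product)
      finally show "card (g ` (J \<times> \<omega>)) \<le> K" .
      have "1 * 1 \<le> k ^ CARD('n) * N" using assms by (intro mult_mono) auto
      then show "1 \<le> K" using assms by linarith
      show "finite (g ` (J \<times> \<omega>))" using J \<omega> by auto
      fix y :: "real ^ 'n" assume y: "\<forall>i. 0 $ i \<le> y $ i \<and> y $ i \<le> 0 $ i + 1"
      then have "\<forall>i. \<exists>j. j < k \<and> real j / k \<le> y $ i \<and> y $ i \<le> real j / k + 1 / k"
        using subcube_index[OF assms(3)] by (metis add_0 zero_index)
      then obtain j where j: "\<And>i. j i < k \<and> real (j i) / k \<le> y $ i \<and> y $ i \<le> real (j i) / k + 1 / k"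
        by metis
      define z where "z = k *\<^sub>R y - (\<chi> i. real (j i))"
      have "z \<in> cbox 0 1"
        using j assms(3) by (auto simp: mem_box_cart z_def field_simps)
      then obtain x where x: "x \<in> \<omega>" "dist z x \<le> mesh_norm \<omega> (cbox 0 1)"
        using dist_le_mesh_norm[OF bounded_cbox \<omega>(2,4)] by blast
      have "y - g (j, x) = (1 / k) *\<^sub>R (z - x)"
        using assms(3) by (simp add: g_def z_def vec_eq_iff field_simps)
      then have "dist y (g (j, x)) = dist z x / k" by (simp add: dist_norm)
      also have "\<dots> \<le> mesh_norm \<omega> (cbox 0 1) / k" using x by (simp add: divide_right_mono)
      finally show "\<exists>x\<in>g ` (J \<times> \<omega>). dist y x \<le> mesh_norm \<omega> (cbox 0 1) / k"
        using x j by (intro bexI[of _ "g (j, x)"]) (auto simp: J_def)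
    qed auto
    then show ?thesis using assms(3) by (simp add: field_simps)
  qed
  then have "k * \<eta> K \<le> \<eta> N"
    unfolding \<eta>_def min_mesh_norm_def[of N]
    by (intro cINF_greatest configs_nonempty infinite_unit_cube)
  then show ?thesis using assms(3) by (simp add: field_simps)
qed

text \<open>A Fekete-type argument. If \<open>N\<close> nearly attains the infimum of
  \<open>N * g N ^ n\<close> and \<open>k\<close> is the largest integer with
  \<open>k ^ n * N \<le> K\<close>, then \<open>K < (k + 1) ^ n * N\<close>, so the value at
  \<open>K\<close> exceeds the value at \<open>N\<close> by a factor of at most
  \<open>((k + 1) / k) ^ n\<close>, which tends to 1.\<close>

lemma tendsto_of_subdivide:
  fixes g :: "nat \<Rightarrow> real"
  assumes n: "n \<ge> 1" and g: "\<And>N. N \<ge> 2 \<Longrightarrow> g N \<ge> 0"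
    and sub: "\<And>N k K. N \<ge> 2 \<Longrightarrow> k \<ge> 1 \<Longrightarrow> K \<ge> k ^ n * N \<Longrightarrow> g K \<le> g N / real k"
  obtains L where "L \<ge> 0" "(\<lambda>N. real N * g N ^ n) \<longlonglongrightarrow> L"
    "\<And>N. N \<ge> 2 \<Longrightarrow> L \<le> real N * g N ^ n"
proof -
  define a where "a N = real N * g N ^ n" for N
  define L where "L = (INF N\<in>{2..}. a N)"
  have a0: "a N \<ge> 0" if "N \<ge> 2" for N using g[OF that] by (simp add: a_def)
  then have bdd: "bdd_below (a ` {2..})" by (auto simp: bdd_below_def)
  have L: "L \<le> a N" if "N \<ge> 2" for N
    unfolding L_def using that by (intro cINF_lower[OF bdd]) auto
  have "L \<ge> 0" unfolding L_def using a0 by (intro cINF_greatest) auto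
  moreover have "a \<longlonglongrightarrow> L"
  proof (rule order_tendstoI)
    fix l assume "l < L"
    then show "\<forall>\<^sub>F K in sequentially. a K > l"
      using L by (intro eventually_sequentiallyI[of 2]) force
  next
    fix u assume "L < u"
    then obtain N where N: "N \<ge> 2" "a N < u"
      unfolding L_def using cINF_less_iff[OF _ bdd] by auto
    have "(\<lambda>k. (1 + 1 / real (Suc k)) ^ n * a N) \<longlonglongrightarrow> (1 + 0) ^ n * a N"
      by (intro tendsto_intros LIMSEQ_Suc lim_1_over_n)
    then have "\<forall>\<^sub>F k in sequentially. (1 + 1 / real (Suc k)) ^ n * a N < u"
      using N by (intro order_tendstoD) auto
    then obtain k0 where k0: "\<And>k. k \<ge> k0 \<Longrightarrow> (1 + 1 / real (Suc k)) ^ n * a N < u"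
      by (auto simp: eventually_sequentially)
    show "\<forall>\<^sub>F K in sequentially. a K < u"
    \<comment> \<open>This threshold makes \<open>Suc k0\<close> admissible, so the greatest
      admissible \<open>k\<close> has the form \<open>Suc l\<close> with
      \<open>l \<ge> k0\<close>.\<close>
    proof (rule eventually_sequentiallyI)
      fix K assume K: "K \<ge> Suc k0 ^ n * N"
      define P where "P k \<longleftrightarrow> k ^ n * N \<le> K" for k
      \<comment> \<open>This bound on the admissible \<open>k\<close> ensures that
        \<open>GREATEST\<close> is attained.\<close>
      have P: "k \<le> K" if "P k" for k
      proof -
        have "k \<le> k ^ n * N"
        proof (cases "k = 0")
          case False
          then have "k ^ 1 \<le> k ^ n" using n by (intro power_increasing) auto
          then have "k * 1 \<le> k ^ n * N" using N by (intro mult_mono) auto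
          then show ?thesis by simp
        qed simp
        then show ?thesis using that by (simp add: P_def)
      qed
      define k where "k = (GREATEST k. P k)"
      have "P (Suc k0)" using K by (simp add: P_def)
      then have k: "P k" "Suc k0 \<le> k"
        unfolding k_def using P GreatestI_nat[of P "Suc k0" K] Greatest_le_nat[of P "Suc k0" K] by auto
      have "\<not> P (Suc k)" using Greatest_le_nat[of P "Suc k" K] P unfolding k_def by force
      then have K_less: "K < Suc k ^ n * N" by (simp add: P_def)
      obtain l where l: "k = Suc l" "l \<ge> k0" using k by (cases k) auto
      have "1 * 2 \<le> k ^ n * N" using k N by (intro mult_mono) auto
      then have "K \<ge> 2" using k(1) unfolding P_def by linarith
      have "a K \<le> real (Suc k ^ n * N) * (g N / k) ^ n"
        unfolding a_def
        using K_less g[OF \<open>K \<ge> 2\<close>] sub[OF N(1), of k K] k l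
        by (intro mult_mono power_mono) (auto simp: P_def simp del: of_nat_mult of_nat_power)
      also have "\<dots> = (real (Suc k) / k) ^ n * a N"
        by (simp add: a_def power_divide)
      also have "real (Suc k) / k = 1 + 1 / real (Suc l)" using l by (simp add: field_simps)
      also have "\<dots> ^ n * a N < u" using k0[OF l(2)] .
      finally show "a K < u" .
    qed
  qed
  ultimately show thesis using that L unfolding a_def by blast
qed

section \<open>Configurations on compact sets and on a cap of the sphere\<close>

text \<open>Finitely many balls of radius \<open>t / 2\<close> cover \<open>A\<close>. Once there
  are more points than balls, two points share a ball.\<close>

lemma separation_tendsto_0:
  fixes \<omega> :: "nat \<Rightarrow> 'a::metric_space set"
  assumes "compact A" "\<And>N. N \<ge> 2 \<Longrightarrow> \<omega> N \<in> configs N A" "t > 0"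
  shows "\<forall>\<^sub>F N in sequentially. separation (\<omega> N) < t"
proof -
  obtain C where C: "finite C" "A \<subseteq> (\<Union>x\<in>C. ball x (t / 2))"
    using assms(1,3) unfolding compact_eq_totally_bounded by (meson half_gt_zero)
  show ?thesis
  proof (rule eventually_sequentiallyI)
    fix N assume N: "N \<ge> max 2 (Suc (card C))"
    then have \<omega>: "\<omega> N \<subseteq> A" "finite (\<omega> N)" "card (\<omega> N) = N"
      using assms(2)[of N] by (auto simp: configs_def)
    have "\<forall>x\<in>\<omega> N. \<exists>c\<in>C. dist c x < t / 2" using C \<omega> by fastforce
    then obtain f where f: "\<And>x. x \<in> \<omega> N \<Longrightarrow> f x \<in> C \<and> dist (f x) x < t / 2" by metis
    have "card (f ` \<omega> N) \<le> card C" using f C(1) by (intro card_mono) auto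
    then have "\<not> inj_on f (\<omega> N)" using N \<omega>(3) by (intro pigeonhole) auto
    then obtain x y where xy: "x \<in> \<omega> N" "y \<in> \<omega> N" "x \<noteq> y" "f x = f y" by (auto simp: inj_on_def)
    have "separation (\<omega> N) \<le> dist x y"
      using xy \<omega> N by (intro separation_le_dist) auto
    also have "\<dots> < t"
      using f[OF xy(1)] f[OF xy(2)] xy(4) dist_triangle_half_r[of "f x" x t y] by simp
    finally show "separation (\<omega> N) < t" .
  qed
qed

text \<open>Pythagoras: \<open>h\<close> enumerates the coordinates other than \<open>p\<close>, so
  composing with \<open>h\<close> is the orthogonal projection along the \<open>p\<close>
  axis.\<close>

lemma norm_forget_coordinate:
  fixes h :: "'n::finite \<Rightarrow> 'm::finite" and x :: "real ^ 'm"
  assumes "inj h" "range h = - {p}"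
  shows "(norm x)\<^sup>2 = (norm (\<chi> i. x $ h i))\<^sup>2 + (x $ p)\<^sup>2"
proof -
  have "(norm x)\<^sup>2 = (\<Sum>j\<in>UNIV. (x $ j)\<^sup>2)"
    unfolding power2_norm_eq_inner by (simp add: inner_vec_def power2_eq_square)
  also have "\<dots> = (x $ p)\<^sup>2 + (\<Sum>j\<in>range h. (x $ j)\<^sup>2)"
    unfolding assms(2) by (simp add: sum.remove[of UNIV p] Compl_eq_Diff_UNIV)
  also have "(\<Sum>j\<in>range h. (x $ j)\<^sup>2) = (\<Sum>i\<in>UNIV. (x $ h i)\<^sup>2)"
    using assms(1) by (simp add: sum.reindex)
  also have "\<dots> = (norm (\<chi> i. x $ h i))\<^sup>2"
    unfolding power2_norm_eq_inner by (simp add: inner_vec_def power2_eq_square)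
  finally show ?thesis by simp
qed

text \<open>On the unit sphere the squared heights differ by the difference of the squared norms of
  the projections. Dividing by the sum of the heights, which is at least 1 on this cap, bounds the
  height difference by \<open>2 * r\<close> times the projected distance.\<close>

lemma dist_le_dist_forget_coordinate:
  fixes h :: "'n::finite \<Rightarrow> 'm::finite" and x y :: "real ^ 'm"
  assumes h: "inj h" "range h = - {p}"
    and x: "norm x = 1" "x $ p > 0" "norm (\<chi> i. x $ h i) \<le> r"
    and y: "norm y = 1" "y $ p > 0" "norm (\<chi> i. y $ h i) \<le> r"
    and r: "r \<le> 1 / 2"
  shows "dist x y \<le> (1 + 2 * r) * dist (\<chi> i. x $ h i) (\<chi> i. y $ h i)"
proof -
  define u v where "u = (\<chi> i. x $ h i)" and "v = (\<chi> i. y $ h i)"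
  note N = norm_forget_coordinate[OF h]
  have large: "z $ p \<ge> 1 / 2" if "norm z = 1" "z $ p > 0" "norm (\<chi> i. z $ h i) \<le> r" for z :: "real ^ 'm"
  proof (rule power2_le_imp_le)
    have "(norm (\<chi> i. z $ h i))\<^sup>2 \<le> (1 / 2)\<^sup>2" using that r by (intro power_mono) auto
    then show "(1 / 2)\<^sup>2 \<le> (z $ p)\<^sup>2" using N[of z] that by (simp add: power2_eq_square)
  qed (use that in simp)
  have sum: "x $ p + y $ p \<ge> 1" using large[OF x] large[OF y] by simp
  have "\<bar>x $ p - y $ p\<bar> * 1 \<le> \<bar>x $ p - y $ p\<bar> * \<bar>x $ p + y $ p\<bar>"
    using sum by (intro mult_left_mono) auto
  also have "\<dots> = \<bar>(x $ p)\<^sup>2 - (y $ p)\<^sup>2\<bar>"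
    by (simp add: abs_mult[symmetric] power2_eq_square algebra_simps)
  also have "(x $ p)\<^sup>2 - (y $ p)\<^sup>2 = (norm v - norm u) * (norm v + norm u)"
    using N[of x] N[of y] x y by (simp add: u_def v_def power2_eq_square algebra_simps)
  also have "\<bar>\<dots>\<bar> = \<bar>norm v - norm u\<bar> * (norm v + norm u)"
    by (simp add: abs_mult)
  also have "\<dots> \<le> dist u v * (2 * r)"
    using x y norm_triangle_ineq3[of v u] by (intro mult_mono) (auto simp: u_def v_def dist_norm norm_minus_commute)
  finally have *: "\<bar>x $ p - y $ p\<bar> \<le> 2 * r * dist u v" by (simp add: mult_ac)
  have "(dist x y)\<^sup>2 = (dist u v)\<^sup>2 + (x $ p - y $ p)\<^sup>2"
  proof -
    have "u - v = (\<chi> i. (x - y) $ h i)" by (simp add: u_def v_def vec_eq_iff)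
    then show ?thesis using N[of "x - y"] by (simp add: dist_norm)
  qed
  also have "\<dots> \<le> (dist u v + \<bar>x $ p - y $ p\<bar>)\<^sup>2"
    by (simp add: power2_sum)
  finally have "dist x y \<le> dist u v + \<bar>x $ p - y $ p\<bar>"
    by (rule power2_le_imp_le) simp
  with * show ?thesis unfolding u_def v_def by (simp add: algebra_simps)
qed

text \<open>\<open>X\<close> is the projection of the points of \<open>\<omega>\<close> lying over
  the \<open>\<eta>\<close>-enlarged cube on the upper hemisphere. The relation between
  \<open>s\<close> and \<open>e\<close> is chosen so that coordinates of size at most
  \<open>2 * s\<close> give norm at most \<open>e / 2\<close>, whence the distortion factor
  \<open>1 + e\<close>.\<close>

lemma sphere_local_config:
  fixes \<omega> :: "(real ^ 'm::finite) set" and s e :: real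
  defines "\<eta> \<equiv> mesh_norm \<omega> (sphere 0 1)"
  assumes card: "CARD('m) = CARD('n::finite) + 1"
    and \<omega>: "finite \<omega>" "card \<omega> \<ge> 2" "\<omega> \<subseteq> sphere 0 1"
    and s: "s > 0" "4 * CARD('n) * s = e" "e \<le> 1" "\<eta> \<le> s"
  obtains X :: "(real ^ 'n) set" where "finite X"
    "\<And>x i. x \<in> X \<Longrightarrow> - \<eta> \<le> x $ i \<and> x $ i \<le> s + \<eta>"
    "\<And>x y. x \<in> X \<Longrightarrow> y \<in> X \<Longrightarrow> x \<noteq> y \<Longrightarrow> separation \<omega> / (1 + e) \<le> dist x y"
    "\<And>y. \<forall>i. 0 \<le> y $ i \<and> y $ i \<le> s \<Longrightarrow> \<exists>x\<in>X. dist y x \<le> \<eta>"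
proof -
  \<comment> \<open>Any coordinate axis may serve as the polar axis.\<close>
  obtain p :: 'm where True by simp
  have "card (- {p}) = CARD('n)" using card by (simp add: Compl_eq_Diff_UNIV)
  then obtain h :: "'n \<Rightarrow> 'm" where "bij_betw h UNIV (- {p})"
    by (metis finite finite_same_card_bij)
  then have h: "inj h" "range h = - {p}" by (auto simp: bij_betw_def)
  define \<pi> :: "real ^ 'm \<Rightarrow> real ^ 'n" where "\<pi> x = (\<chi> i. x $ h i)" for x
  have norm_\<pi>: "(norm x)\<^sup>2 = (norm (\<pi> x))\<^sup>2 + (x $ p)\<^sup>2" for x
    unfolding \<pi>_def by (rule norm_forget_coordinate[OF h])
  have "\<omega> \<noteq> {}" using \<omega> by auto
  moreover have "sphere (0 :: real ^ 'm) 1 \<noteq> {}" using \<omega> \<open>\<omega> \<noteq> {}\<close> by auto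
  ultimately have \<eta>0: "\<eta> \<ge> 0"
    unfolding \<eta>_def using \<omega> by (intro mesh_norm_nonneg) auto
  have e: "e > 0" using s by auto
  have norm_le: "norm u \<le> CARD('n) * B" if "\<And>i. \<bar>u $ i\<bar> \<le> B" for u :: "real ^ 'n" and B :: real
  proof -
    have "norm u \<le> (\<Sum>i\<in>UNIV. \<bar>u $ i\<bar>)" by (rule norm_le_l1_cart)
    also have "\<dots> \<le> (\<Sum>i\<in>(UNIV :: 'n set). B)" using that by (intro sum_mono) auto
    finally show ?thesis by simp
  qed
  have "4 * 1 * s \<le> 4 * real CARD('n) * s"
    using s(1) by (intro mult_right_mono mult_left_mono) (auto simp: Suc_le_eq)
  then have s4: "4 * s \<le> 1" using s by linarith
  define Y where "Y = {x \<in> \<omega>. x $ p > 0 \<and> (\<forall>i. - \<eta> \<le> \<pi> x $ i \<and> \<pi> x $ i \<le> s + \<eta>)}"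
  have Y: "norm (\<pi> x) \<le> e / 2" if "x \<in> Y" for x
  proof -
    have "\<bar>\<pi> x $ i\<bar> \<le> 2 * s" for i
    proof -
      have "- \<eta> \<le> \<pi> x $ i \<and> \<pi> x $ i \<le> s + \<eta>" using that by (simp add: Y_def)
      then show ?thesis using s(1,4) \<eta>0 by linarith
    qed
    then show ?thesis using norm_le[of "\<pi> x" "2 * s"] s(2) by simp
  qed
  show thesis
  proof
    show "finite (\<pi> ` Y)" using \<omega> by (simp add: Y_def)
    show "- \<eta> \<le> x $ i \<and> x $ i \<le> s + \<eta>" if "x \<in> \<pi> ` Y" for x i
      using that by (auto simp: Y_def)
    show "separation \<omega> / (1 + e) \<le> dist u v" if uv: "u \<in> \<pi> ` Y" "v \<in> \<pi> ` Y" "u \<noteq> v" for u v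
    proof -
      from uv obtain x y where xy: "x \<in> Y" "y \<in> Y" "u = \<pi> x" "v = \<pi> y" "x \<noteq> y" by blast
      then have "x \<in> \<omega>" "y \<in> \<omega>" "x $ p > 0" "y $ p > 0" by (auto simp: Y_def)
      then have "separation \<omega> \<le> dist x y" using \<omega> xy(5) by (intro separation_le_dist)
      also have "dist x y \<le> (1 + 2 * (e / 2)) * dist (\<pi> x) (\<pi> y)"
        unfolding \<pi>_def using Y[OF xy(1)] Y[OF xy(2)] \<omega> \<open>x \<in> \<omega>\<close> \<open>y \<in> \<omega>\<close> \<open>x $ p > 0\<close> \<open>y $ p > 0\<close> s(3)
        by (intro dist_le_dist_forget_coordinate[OF h]) (auto simp: \<pi>_def)
      finally show ?thesis using e xy by (simp add: field_simps)
    qed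
    fix y :: "real ^ 'n" assume y: "\<forall>i. 0 \<le> y $ i \<and> y $ i \<le> s"
    have "norm y \<le> CARD('n) * s" using y by (intro norm_le) auto
    then have ny: "norm y \<le> 1 / 4" using s(2,3) by simp
    then have "(norm y)\<^sup>2 \<le> (1 / 4)\<^sup>2" by (intro power_mono) auto
    then have ny2: "1 - (norm y)\<^sup>2 \<ge> (1 / 2)\<^sup>2" by (simp add: power2_eq_square)
    \<comment> \<open>\<open>z\<close> is the lift of \<open>y\<close> to the upper hemisphere; a
      point of \<open>\<omega>\<close> within \<open>\<eta>\<close> of \<open>z\<close> will project
      to a point within \<open>\<eta>\<close> of \<open>y\<close>.\<close>
    define z :: "real ^ 'm" where "z = (\<chi> j. if j = p then sqrt (1 - (norm y)\<^sup>2) else y $ inv h j)"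
    have "h i \<noteq> p" for i using h(2) by auto
    then have \<pi>z: "\<pi> z = y" using h(1) by (simp add: \<pi>_def z_def vec_eq_iff)
    have "1 - (norm y)\<^sup>2 \<ge> 0" using ny2 by (rule order_trans[rotated]) simp
    then have "(z $ p)\<^sup>2 = 1 - (norm y)\<^sup>2" by (simp add: z_def)
    then have "(norm z)\<^sup>2 = 1" using norm_\<pi>[of z] by (simp add: \<pi>z)
    then have "z \<in> sphere 0 1" by (simp add: power2_eq_1_iff) (use norm_ge_zero[of z] in linarith)
    then obtain x where x: "x \<in> \<omega>" "dist z x \<le> \<eta>"
      using dist_le_mesh_norm[of "sphere 0 1" \<omega> z] \<omega>(1) \<open>\<omega> \<noteq> {}\<close> unfolding \<eta>_def by auto
    have zp: "z $ p \<ge> 1 / 2" using real_le_rsqrt[OF ny2] by (simp add: z_def)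
    have coord: "\<bar>z $ j - x $ j\<bar> \<le> \<eta>" for j
      using component_le_norm_cart[of "z - x" j] x(2) by (simp add: dist_norm)
    \<comment> \<open>The height of \<open>z\<close> is at least 1/2 and
      \<open>\<eta> \<le> s \<le> 1/4\<close>, so \<open>x\<close> stays in the upper
      hemisphere.\<close>
    have "x $ p > 0" using coord[of p] zp s4 s(4) by linarith
    moreover have "- \<eta> \<le> \<pi> x $ i \<and> \<pi> x $ i \<le> s + \<eta>" for i
    proof -
      have "z $ h i = y $ i" using \<pi>z by (auto simp: \<pi>_def)
      then show ?thesis using coord[of "h i"] spec[OF y, of i] by (auto simp: \<pi>_def abs_le_iff)
    qed
    ultimately have "x \<in> Y" using x by (simp add: Y_def)
    moreover have "dist y (\<pi> x) \<le> \<eta>"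
    proof -
      have "\<pi> (z - x) = y - \<pi> x" using \<pi>z by (auto simp: \<pi>_def vec_eq_iff)
      then have "(dist y (\<pi> x))\<^sup>2 \<le> (dist z x)\<^sup>2" using norm_\<pi>[of "z - x"] by (simp add: dist_norm)
      then have "dist y (\<pi> x) \<le> dist z x" by (rule power2_le_imp_le) simp
      with x show ?thesis by simp
    qed
    ultimately show "\<exists>x\<in>\<pi> ` Y. dist y x \<le> \<eta>" by blast
  qed
qed

section \<open>Comparison of packing and covering on the sphere\<close>

text \<open>The condition on \<open>T\<close> says that \<open>T\<close> lies below the n-th root of
  \<open>c / p\<close>, written without division. A failure of the bound would yield one local
  configuration that covers too well for its number of points, given its separation.\<close>

lemma mesh_norm_ge_separation:
  fixes \<omega> :: "nat \<Rightarrow> (real ^ 'm::finite) set"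
  defines "\<delta> \<equiv> \<lambda>N. max_separation N (cbox 0 1 :: (real ^ 'n::finite) set)"
    and "\<kappa> \<equiv> \<lambda>N. min_mesh_norm N (cbox 0 1 :: (real ^ 'n) set)"
  assumes card: "CARD('m) = CARD('n) + 1"
    and \<omega>: "\<And>N. N \<ge> 2 \<Longrightarrow> \<omega> N \<in> configs N (sphere 0 1)"
    and p: "p \<ge> 0" "(\<lambda>N. real N * \<delta> N ^ CARD('n)) \<longlonglongrightarrow> p"
    and c: "\<And>N. N \<ge> 2 \<Longrightarrow> c \<le> real N * \<kappa> N ^ CARD('n)"
    and T: "T > 0" "p * T ^ CARD('n) < c"
  shows "\<forall>\<^sub>F N in sequentially. T * separation (\<omega> N) \<le> mesh_norm (\<omega> N) (sphere 0 1)"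
proof -
  define n where "n = CARD('n)"
  have n: "n \<ge> 1" by (simp add: n_def Suc_le_eq)
  \<comment> \<open>The strict inequality for \<open>T\<close> leaves room for an error
    \<open>e\<close> in \<open>p\<close> and two factors \<open>1 + e\<close>: one from the
    projection, one from enlarging the side \<open>s\<close> to
    \<open>s + 2 * \<eta>\<close>.\<close>
  have "((\<lambda>e. (p + e) * (T * (1 + e) ^ 2) ^ n) \<longlongrightarrow> (p + 0) * (T * (1 + 0) ^ 2) ^ n) (at_right (0::real))"
    by (intro tendsto_intros)
  then have "\<forall>\<^sub>F e in at_right 0. (p + e) * (T * (1 + e) ^ 2) ^ n < c"
    using T by (intro order_tendstoD) (auto simp: n_def)
  moreover have "\<forall>\<^sub>F e in at_right (0::real). e \<le> 1"
    unfolding eventually_at_right_field by (intro exI[of _ 1]) auto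
  moreover have "\<forall>\<^sub>F e in at_right (0::real). e > 0"
    by (rule eventually_at_right_less)
  ultimately have "\<forall>\<^sub>F e in at_right 0. (p + e) * (T * (1 + e) ^ 2) ^ n < c \<and> e \<le> 1 \<and> e > 0"
    by eventually_elim auto
  then obtain e where e: "(p + e) * (T * (1 + e) ^ 2) ^ n < c" "e \<le> 1" "e > 0"
    using eventually_happens'[OF trivial_limit_at_right_real] by blast
  define s where "s = e / (4 * n)"
  have s: "s > 0" "4 * n * s = e" using e n by (auto simp: s_def)
  have "\<forall>\<^sub>F m in sequentially. real m * \<delta> m ^ n < p + e"
    using p(2) e(3) unfolding n_def by (intro order_tendstoD) auto
  then obtain m1 where m1: "\<And>m. m \<ge> m1 \<Longrightarrow> real m * \<delta> m ^ n < p + e"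
    by (auto simp: eventually_sequentially)
  define m0 where "m0 = max 2 m1"
  \<comment> \<open>\<open>t\<close> will bound \<open>\<eta>\<close>. It is so small that
    \<open>m0\<close> points cannot cover the cube of side \<open>s\<close> with radius
    \<open>t\<close>, and that \<open>s + 2 * t \<le> (1 + e) * s\<close>.\<close>
  have "((\<lambda>t. real m0 * (t / s) ^ n) \<longlongrightarrow> real m0 * (0 / s) ^ n) (at_right 0)"
    using s by (intro tendsto_intros) auto
  moreover have c0: "c > 0"
    using T p(1) by (meson le_less_trans mult_nonneg_nonneg zero_le_power less_imp_le)
  ultimately have "\<forall>\<^sub>F t in at_right 0. real m0 * (t / s) ^ n < c"
    using n by (intro order_tendstoD(2)[where y = "real m0 * (0 / s) ^ n"]) (auto simp: zero_power)
  moreover have "\<forall>\<^sub>F t in at_right (0::real). t \<le> e * s / 2"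
    unfolding eventually_at_right_field using e s by (intro exI[of _ "e * s / 2"]) auto
  moreover have "\<forall>\<^sub>F t in at_right (0::real). t > 0"
    by (rule eventually_at_right_less)
  ultimately have "\<forall>\<^sub>F t in at_right 0. real m0 * (t / s) ^ n < c \<and> t \<le> e * s / 2 \<and> t > 0"
    by eventually_elim auto
  then obtain t where t: "real m0 * (t / s) ^ n < c" "t \<le> e * s / 2" "t > 0"
    using eventually_happens'[OF trivial_limit_at_right_real] by blast
  have "\<forall>\<^sub>F N in sequentially. separation (\<omega> N) < t / T"
    using T(1) t(3) \<omega> by (intro separation_tendsto_0[where A = "sphere 0 1"]) auto
  then show ?thesis
    using eventually_ge_at_top[of 2]
  proof eventually_elim
    fix N assume sep: "separation (\<omega> N) < t / T" and N: "N \<ge> 2"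
    have \<omega>N: "finite (\<omega> N)" "card (\<omega> N) \<ge> 2" "\<omega> N \<subseteq> sphere 0 1"
      using \<omega>[OF N] N by (auto simp: configs_def)
    define \<eta> where "\<eta> = mesh_norm (\<omega> N) (sphere 0 1)"
    define D where "D = separation (\<omega> N) / (1 + e)"
    have D: "D > 0" using separation_pos[OF \<omega>N(1,2)] e by (simp add: D_def)
    show "T * separation (\<omega> N) \<le> \<eta>"
    proof (rule ccontr)
      assume "\<not> T * separation (\<omega> N) \<le> \<eta>"
      moreover have sep_eq: "separation (\<omega> N) = (1 + e) * D" using e by (simp add: D_def)
      ultimately have small: "\<eta> < T * ((1 + e) * D)" by simp
      moreover have "T * ((1 + e) * D) < t"
        using sep T(1) unfolding sep_eq by (simp only: pos_less_divide_eq) (simp only: mult_ac)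
      ultimately have \<eta>t: "\<eta> < t" by simp
      moreover have "e * s \<le> 1 * s" using e s by (intro mult_right_mono) auto
      ultimately have \<eta>s: "\<eta> \<le> s" using t(2) s(1) by linarith
      obtain X :: "(real ^ 'n) set" where X: "finite X"
        "\<And>x i. x \<in> X \<Longrightarrow> - \<eta> \<le> x $ i \<and> x $ i \<le> s + \<eta>"
        "\<And>x y. x \<in> X \<Longrightarrow> y \<in> X \<Longrightarrow> x \<noteq> y \<Longrightarrow> D \<le> dist x y"
        "\<And>y. \<forall>i. 0 \<le> y $ i \<and> y $ i \<le> s \<Longrightarrow> \<exists>x\<in>X. dist y x \<le> \<eta>"
        by (rule sphere_local_config[where 'n = 'n, OF card \<omega>N s(1) s(2)[unfolded n_def] e(2)
              \<eta>s[unfolded \<eta>_def], folded \<eta>_def D_def]) (rule that)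
      obtain x where "x \<in> X" "dist 0 x \<le> \<eta>" using X(4)[of 0] s(1) by auto
      then have \<eta>0: "\<eta> \<ge> 0" using zero_le_dist order_trans by blast
      have cov: "\<kappa> m \<le> \<eta> / s" if "card X \<le> m" "m \<ge> 1" for m
        unfolding \<kappa>_def using X(1,4) that s(1)
        by (intro min_mesh_norm_unit_cube_le[where X = X and a = 0]) auto
      \<comment> \<open>Allowing any \<open>m\<close> above the cardinality of \<open>X\<close> lets
        this bound be applied to \<open>m0\<close> first, to show that \<open>X\<close> has many
        points.\<close>
      have c_le: "c \<le> real m * (\<eta> / s) ^ n" if "card X \<le> m" "m \<ge> 2" for m
      proof -
        have "\<kappa> m \<ge> 0" unfolding \<kappa>_def using that
          by (intro min_mesh_norm_nonneg infinite_unit_cube) auto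
        then have "real m * \<kappa> m ^ n \<le> real m * (\<eta> / s) ^ n"
          using cov that by (intro mult_left_mono power_mono) auto
        with c[OF that(2)] show ?thesis unfolding n_def by simp
      qed
      define m where "m = card X"
      have "m > m0"
      proof (rule ccontr)
        assume "\<not> m > m0"
        then have "c \<le> real m0 * (\<eta> / s) ^ n" by (intro c_le) (auto simp: m_def m0_def)
        also have "\<dots> \<le> real m0 * (t / s) ^ n"
          using \<eta>0 \<eta>t s(1) by (intro mult_left_mono power_mono divide_right_mono) auto
        finally show False using t(1) by simp
      qed
      then have m: "m \<ge> 2" "m \<ge> m1" by (auto simp: m0_def)
      have side: "0 < s + 2 * \<eta>" "s + 2 * \<eta> \<le> (1 + e) * s"
        using \<eta>0 \<eta>t t(2) s(1) by (auto simp: algebra_simps)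
      have \<delta>m: "D / (s + 2 * \<eta>) \<le> \<delta> m"
        unfolding \<delta>_def
      proof (rule max_separation_unit_cube_ge[where X = X and a = "\<chi> i. - \<eta>"])
        show "(\<chi> i. - \<eta>) $ i \<le> x $ i \<and> x $ i \<le> (\<chi> i. - \<eta>) $ i + (s + 2 * \<eta>)"
          if "x \<in> X" for x i
          using X(2)[OF that, of i] by simp
      qed (use X m side m_def in auto)
      \<comment> \<open>Used with \<open>f = 1 + e\<close>, this gathers the two distortion factors
        into a square.\<close>
      have cancel: "T * (f * D) / s = T * f\<^sup>2 * (D / (f * s))" if "f > 0" for f
        using that s(1) by (simp add: power2_eq_square field_simps)
      have "\<eta> / s \<le> T * ((1 + e) * D) / s"
        using small s(1) by (intro divide_right_mono) auto
      also have "\<dots> = T * (1 + e)\<^sup>2 * (D / ((1 + e) * s))"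
        using e by (intro cancel) simp
      also have "\<dots> \<le> T * (1 + e)\<^sup>2 * (D / (s + 2 * \<eta>))"
        using side D T(1) e by (intro mult_left_mono divide_left_mono) auto
      also have "\<dots> \<le> T * (1 + e)\<^sup>2 * \<delta> m"
        using \<delta>m T(1) by (intro mult_left_mono) auto
      finally have power_le: "(\<eta> / s) ^ n \<le> (T * (1 + e)\<^sup>2 * \<delta> m) ^ n"
        using \<eta>0 s(1) by (intro power_mono) auto
      have "c \<le> real m * (\<eta> / s) ^ n"
        using m(1) by (intro c_le) (simp_all add: m_def)
      also have "\<dots> \<le> real m * (T * (1 + e)\<^sup>2 * \<delta> m) ^ n"
        by (intro mult_left_mono power_le) simp
      also have "\<dots> = (real m * \<delta> m ^ n) * (T * (1 + e)\<^sup>2) ^ n"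
        by (simp add: power_mult_distrib mult_ac)
      also have "\<dots> \<le> (p + e) * (T * (1 + e)\<^sup>2) ^ n"
        using m1[OF m(2)] T(1) e by (intro mult_right_mono) auto
      finally show False using e(1) by simp
    qed
  qed
qed

section \<open>The two constants and the asymptotic bound\<close>

lemma packing_const_limit:
  obtains p where "p \<ge> 0"
    "(\<lambda>N. real N * max_separation N (cbox 0 1 :: (real ^ 'n::finite) set) ^ CARD('n)) \<longlonglongrightarrow> p"
    "packing_const TYPE('n) = p / 2 ^ CARD('n) * measure lborel (cball (0 :: real ^ 'n) 1)"
proof -
  have "max_separation N (cbox 0 1 :: (real ^ 'n) set) \<ge> 0" if "N \<ge> 2" for N
  proof -
    obtain \<omega> :: "(real ^ 'n) set" where "\<omega> \<in> configs N (cbox 0 1)"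
      using configs_nonempty[OF infinite_unit_cube] by blast
    then show ?thesis
      using that by (intro max_separation_ge[where \<omega> = \<omega>]) (auto simp: configs_def)
  qed
  note nonneg = this
  obtain p where p: "p \<ge> 0"
    "(\<lambda>N. real N * max_separation N (cbox 0 1 :: (real ^ 'n) set) ^ CARD('n)) \<longlonglongrightarrow> p"
    by (rule tendsto_of_subdivide[where n = "CARD('n)"
          and g = "\<lambda>N. max_separation N (cbox 0 1 :: (real ^ 'n) set)"])
      (use nonneg max_separation_subdivide[where 'n = 'n] in \<open>auto simp: Suc_le_eq\<close>)
  have "(\<lambda>N. real N * (max_separation N (cbox 0 1 :: (real ^ 'n) set) / 2) ^ CARD('n)
     * measure lborel (cball (0 :: real ^ 'n) 1))
    \<longlonglongrightarrow> p / 2 ^ CARD('n) * measure lborel (cball (0 :: real ^ 'n) 1)"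
    using tendsto_mult_right[OF tendsto_divide[OF p(2) tendsto_const, of "2 ^ CARD('n)"]]
    by (simp add: power_divide)
  then have "packing_const TYPE('n) = p / 2 ^ CARD('n) * measure lborel (cball (0 :: real ^ 'n) 1)"
    unfolding packing_const_def by (rule limI)
  with p show thesis by (rule that)
qed

text \<open>Since the limit is an infimum, \<open>c\<close> bounds the covering quantity from below
  at every \<open>N \<ge> 2\<close> with no error term, which is the form used in the
  comparison.\<close>

lemma covering_const_limit:
  obtains c where "c \<ge> 0"
    "\<And>N. N \<ge> 2 \<Longrightarrow> c \<le> real N * min_mesh_norm N (cbox 0 1 :: (real ^ 'n::finite) set) ^ CARD('n)"
    "covering_const TYPE('n) = c * measure lborel (cball (0 :: real ^ 'n) 1)"
proof -
  have "min_mesh_norm N (cbox 0 1 :: (real ^ 'n) set) \<ge> 0" if "N \<ge> 2" for N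
    using that by (intro min_mesh_norm_nonneg infinite_unit_cube) auto
  note nonneg = this
  obtain c where c: "c \<ge> 0"
    "(\<lambda>N. real N * min_mesh_norm N (cbox 0 1 :: (real ^ 'n) set) ^ CARD('n)) \<longlonglongrightarrow> c"
    "\<And>N. N \<ge> 2 \<Longrightarrow> c \<le> real N * min_mesh_norm N (cbox 0 1 :: (real ^ 'n) set) ^ CARD('n)"
    by (rule tendsto_of_subdivide[where n = "CARD('n)"
          and g = "\<lambda>N. min_mesh_norm N (cbox 0 1 :: (real ^ 'n) set)"])
      (use nonneg min_mesh_norm_subdivide[where 'n = 'n] in \<open>auto simp: Suc_le_eq\<close>)
  have "covering_const TYPE('n) = c * measure lborel (cball (0 :: real ^ 'n) 1)"
    unfolding covering_const_def by (rule limI, rule tendsto_mult_right, rule c(2))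
  with c show thesis by (intro that)
qed

theorem theorem4:
  fixes n :: nat
    and \<omega> :: "nat \<Rightarrow> (real ^ 'm::finite) set"
  assumes "n \<ge> 1"
    and "CARD('n::finite) = n"
    and "CARD('m) = n + 1"
    and "\<And>N. N \<ge> 2 \<Longrightarrow> best_packing N (sphere 0 1) (\<omega> N)"
  shows "\<exists>r \<in> o(\<lambda>_. 1). \<forall>N\<ge>2. mesh_ratio (\<omega> N) (sphere 0 1)
           \<ge> 1 / 2 * (covering_const TYPE('n) / packing_const TYPE('n)) powr (1 / real n) + r N"
proof -
  obtain p where p: "p \<ge> 0"
    "(\<lambda>N. real N * max_separation N (cbox 0 1 :: (real ^ 'n::finite) set) ^ CARD('n)) \<longlonglongrightarrow> p"
    "packing_const TYPE('n) = p / 2 ^ CARD('n) * measure lborel (cball (0 :: real ^ 'n) 1)"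
    by (rule packing_const_limit[where 'n = 'n])
  obtain c where c: "c \<ge> 0"
    "\<And>N. N \<ge> 2 \<Longrightarrow> c \<le> real N * min_mesh_norm N (cbox 0 1 :: (real ^ 'n::finite) set) ^ CARD('n)"
    "covering_const TYPE('n) = c * measure lborel (cball (0 :: real ^ 'n) 1)"
    using covering_const_limit[where 'n = 'n] by blast
  define T where "T = 1 / 2 * (covering_const TYPE('n) / packing_const TYPE('n)) powr (1 / real n)"
  define q where "q N = mesh_ratio (\<omega> N) (sphere 0 1)" for N
  \<comment> \<open>The volume of the unit ball cancels. The factor \<open>2 ^ n\<close> comes from
    halving the separation and offsets the 1/2 in \<open>T\<close>.\<close>
  have "covering_const TYPE('n) / packing_const TYPE('n) = 2 ^ n * (c / p)"
  proof -
    have "measure lborel (cball (0 :: real ^ 'n) 1) > 0" by simp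
    then show ?thesis unfolding p(3) c(3) using assms(2) by simp
  qed
  also have "\<dots> powr (1 / real n) = 2 * (c / p) powr (1 / real n)"
    using p(1) c(1) assms(1) by (subst powr_mult) (auto simp: powr_powr simp flip: powr_realpow)
  finally have T_eq: "T = (c / p) powr (1 / real n)" by (simp add: T_def)
  have \<omega>: "\<omega> N \<in> configs N (sphere 0 1)" if "N \<ge> 2" for N
    using assms(4)[OF that] by (simp add: best_packing_def)
  have q0: "q N \<ge> 0" if "N \<ge> 2" for N
  proof -
    have *: "finite (\<omega> N)" "card (\<omega> N) \<ge> 2" "\<omega> N \<noteq> {}" "\<omega> N \<subseteq> sphere 0 1"
      using \<omega>[OF that] that by (auto simp: configs_def)
    then have "mesh_norm (\<omega> N) (sphere 0 1) \<ge> 0" by (intro mesh_norm_nonneg) auto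
    then show ?thesis
      unfolding q_def mesh_ratio_def using separation_pos[OF *(1,2)] by simp
  qed
  have lower: "\<forall>\<^sub>F N in sequentially. T' \<le> q N" if "T' < T" for T'
  proof (cases "T' > 0")
    case False
    then show ?thesis using q0 by (intro eventually_sequentiallyI[of 2]) force
  next
    case True
    then have "T > 0" using that by simp
    \<comment> \<open>With \<open>p = 0\<close> the quotient \<open>c / p\<close> would be 0 by
      convention, and so would \<open>T\<close>.\<close>
    then have "p \<noteq> 0" unfolding T_eq by auto
    then have p0: "p > 0" using p(1) by simp
    have "T' ^ n < T ^ n" using True that assms(1) by (intro power_strict_mono) auto
    also have "T ^ n = c / p"
      using assms(1) p0 c(1) \<open>T > 0\<close>
      by (auto simp: T_eq powr_powr simp flip: powr_realpow)
    finally have "p * T' ^ CARD('n) < c" using p0 assms(2) by (simp add: field_simps)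
    then have "\<forall>\<^sub>F N in sequentially. T' * separation (\<omega> N) \<le> mesh_norm (\<omega> N) (sphere 0 1)"
      using assms(2,3) True
      by (intro mesh_norm_ge_separation[where 'n = 'n, OF _ \<omega> p(1,2) c(2)]) auto
    then show ?thesis
      using eventually_ge_at_top[of 2]
    proof eventually_elim
      case (elim N)
      have "separation (\<omega> N) > 0"
        using \<omega>[OF elim(2)] elim(2) by (intro separation_pos) (auto simp: configs_def)
      then show ?case using elim(1) by (simp add: q_def mesh_ratio_def field_simps)
    qed
  qed
  \<comment> \<open>Cutting off at 0 makes the inequality hold for every \<open>N \<ge> 2\<close>,
    while \<open>r\<close> tends to 0 by the eventual lower bounds on \<open>q\<close>
    alone.\<close>
  define r where "r N = min 0 (q N - T)" for N
  have "r \<longlonglongrightarrow> 0"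
  proof (rule order_tendstoI)
    fix l :: real assume "l < 0"
    then show "\<forall>\<^sub>F N in sequentially. r N > l"
      using lower[of "T + l / 2"] by (auto simp: r_def elim!: eventually_mono)
  next
    fix u :: real assume "u > 0"
    then show "\<forall>\<^sub>F N in sequentially. r N < u" by (simp add: r_def min_less_iff_disj)
  qed
  then have "r \<in> o(\<lambda>_. 1)" by (intro smalloI_tendsto) auto
  moreover have "\<forall>N\<ge>2. q N \<ge> T + r N" by (simp add: r_def min_def)
  ultimately show ?thesis unfolding T_def q_def by blast
qed

end
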